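(* Let $\lambda_1,\lambda_2,\lambda\in(0,1]$, let $f\in\mathcal{U}(\lambda_1)$, $g\in\mathcal{U}(\lambda_2)$, and suppose that $\frac{f(z)+g(z)}{z}\neq0$ for all $z\in\mathbb{D}$ (with the value at $z=0$ understood as the limit $2$). Define $$F(z)=\frac{2f(z)g(z)}{f(z)+g(z)},\qquad z\in\mathbb{D}$$ (with $F(0)=0$), and $G(z)=r^{-1}F(rz)$. Then $G$ belongs to $\mathcal{U}(\lambda)$ whenever $$0<r\le\sqrt{\frac{-K^2+K\sqrt{K^2+4}}{2}}\quad\text{with}\quad K=\sqrt{\frac{2\lambda^2}{\lambda_1+\lambda_2}}.$$ In particular, if $f,g\in\mathcal{U}$, then $G\in\mathcal{U}$ for $0<r\le\sqrt{\frac{\sqrt5-1}{2}}$; that is, $F$ is univalent in the disk $|z|<\sqrt{\frac{\sqrt5-1}{2}}$.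
   Context: $\mathbb{D}=\{z\in\mathbb{C}:|z|<1\}$. $\mathcal{A}$ is the class of functions $f$ analytic in $\mathbb{D}$ with $f(0)=0$, $f'(0)=1$. For $\lambda\in(0,1]$, $\mathcal{U}(\lambda)$ is the set of $f\in\mathcal{A}$ (with $f(z)/z\ne0$ in $\mathbb{D}$) satisfying $$\left|f'(z)\left(\frac{z}{f(z)}\right)^2-1\right|<\lambda\quad\text{for all } z\in\mathbb{D},$$ where $z/f(z)$ is taken to be $1$ at $z=0$; and $\mathcal{U}:=\mathcal{U}(1)$. Functions in $\mathcal{U}$ are known to be univalent (injective) in $\mathbb{D}$. *)

theory Defs
  imports "HOL-Complex_Analysis.Complex_Analysis"
begin

text \<open>
  Functions on the unit disk are total functions \<^typ>\<open>complex \<Rightarrow> complex\<close> of which only the values on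
  \<^term>\<open>ball (0::complex) 1\<close> matter. A quotient with a removable singularity at the origin is given
  its limit there explicitly, since division by zero yields zero.
\<close>

definition class_A :: "(complex \<Rightarrow> complex) set" where
  "class_A = {f. f analytic_on ball 0 1 \<and> f 0 = 0 \<and> deriv f 0 = 1}"

definition class_U_lam :: "real \<Rightarrow> (complex \<Rightarrow> complex) set" where
  "class_U_lam l = {f \<in> class_A.
     (\<forall>z\<in>ball 0 1. (if z = 0 then 1 else f z / z) \<noteq> 0) \<and>
     (\<forall>z\<in>ball 0 1. norm (deriv f z * (if z = 0 then 1 else z / f z)\<^sup>2 - 1) < l)}"

definition class_U :: "(complex \<Rightarrow> complex) set" where
  "class_U = class_U_lam 1"

definition harmonic_mean_fun :: "(complex \<Rightarrow> complex) \<Rightarrow> (complex \<Rightarrow> complex) \<Rightarrow> complex \<Rightarrow> complex" where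
  "harmonic_mean_fun f g z = (if z = 0 then 0 else 2 * f z * g z / (f z + g z))"

definition dilation :: "real \<Rightarrow> (complex \<Rightarrow> complex) \<Rightarrow> complex \<Rightarrow> complex" where
  "dilation r F z = inverse (of_real r) * F (of_real r * z)"

definition K_const :: "real \<Rightarrow> real \<Rightarrow> real \<Rightarrow> real" where
  "K_const l1 l2 l = sqrt (2 * l\<^sup>2 / (l1 + l2))"

end

theory Submission
  imports Defs
begin

text \<open>
  Passing to reciprocals makes the problem linear. A function \<open>f\<close> of the disk, normalised and
  without zeros other than the origin, has \<open>1 / f z = 1 / z + w z\<close> with \<open>w\<close> holomorphic in the whole
  disk, and then \<open>f' z * (z / f z)\<^sup>2 - 1 = - z\<^sup>2 * w' z\<close>. So membership in \<open>\<U>(\<lambda>)\<close> says that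
  \<open>\<bar>z\<^sup>2 * w' z\<bar> < \<lambda>\<close>, and the maximum modulus principle removes the factor \<open>z\<^sup>2\<close>: \<open>\<bar>w' z\<bar> \<le> \<lambda>\<close>.

  The reciprocal of the harmonic mean \<open>F\<close> of \<open>f\<close> and \<open>g\<close> is the average of \<open>1 / f\<close> and \<open>1 / g\<close>, so
  the two functions \<open>w\<close> are averaged as well, and \<open>F\<close> lies in \<open>\<U>((\<lambda>\<^sub>1 + \<lambda>\<^sub>2) / 2)\<close>; the hypothesis
  that \<open>(f z + g z) / z\<close> does not vanish keeps \<open>F\<close> free of poles. The dilation \<open>F (r * z) / r\<close> replaces
  \<open>w z\<close> by \<open>r * w (r * z)\<close>, whose derivative is at most \<open>r\<^sup>2 * (\<lambda>\<^sub>1 + \<lambda>\<^sub>2) / 2\<close> in modulus. Hence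
  the dilation lies in \<open>\<U>(\<lambda>)\<close> as soon as \<open>r \<le> 1\<close> and \<open>r\<^sup>2 * (\<lambda>\<^sub>1 + \<lambda>\<^sub>2) / 2 \<le> \<lambda>\<close>, and an
  elementary estimate shows that the radius in terms of \<open>K\<close> satisfies both.

  Univalence is the same idea once more: if \<open>\<bar>w'\<bar> \<le> 1\<close>, then \<open>w\<close> is nonexpansive, whereas
  \<open>z \<mapsto> 1 / z\<close> strictly expands distances in the punctured disk, so \<open>1 / z + w z\<close> is injective.
\<close>

section \<open>The reciprocal form of functions in the class\<close>

text \<open>
  The function \<open>w\<close> below is the regular part of \<open>1 / f\<close> at its simple pole. The equation for \<open>f\<close> is
  solved for \<open>f z\<close> so that it also covers the origin.
\<close>

definition reciprocal_form :: "(complex \<Rightarrow> complex) \<Rightarrow> (complex \<Rightarrow> complex) \<Rightarrow> bool" where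
  "reciprocal_form f w \<longleftrightarrow> w holomorphic_on ball 0 1 \<and>
     (\<forall>z\<in>ball 0 1. 1 + z * w z \<noteq> 0 \<and> f z = z / (1 + z * w z))"

lemma reciprocal_form_has_derivative:
  assumes "reciprocal_form f w" "z \<in> ball 0 1"
  shows "(f has_field_derivative (1 - z\<^sup>2 * deriv w z) / (1 + z * w z)\<^sup>2) (at z)"
proof -
  have w: "(w has_field_derivative deriv w z) (at z)"
    using assms unfolding reciprocal_form_def by (blast intro: holomorphic_derivI)
  have nz: "1 + z * w z \<noteq> 0"
    using assms by (simp add: reciprocal_form_def)
  have "((\<lambda>z. z / (1 + z * w z)) has_field_derivative
          (1 - z\<^sup>2 * deriv w z) / (1 + z * w z)\<^sup>2) (at z)"
    by (rule derivative_eq_intros w refl nz | simp)+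
       (simp add: algebra_simps power2_eq_square)
  then show ?thesis
    by (rule has_field_derivative_transform_within_open[where S = "ball 0 1"])
       (use assms in \<open>auto simp: reciprocal_form_def\<close>)
qed

text \<open>
  This is the computation behind everything: the quantity defining the class is, up to sign,
  \<open>z\<^sup>2 * w' z\<close>, which is linear in \<open>w\<close>.
\<close>

lemma reciprocal_form_U_functional:
  assumes "reciprocal_form f w" "z \<in> ball 0 1"
  shows "deriv f z * (if z = 0 then 1 else z / f z)\<^sup>2 - 1 = - (z\<^sup>2 * deriv w z)"
proof -
  have nz: "1 + z * w z \<noteq> 0" and f: "f z = z / (1 + z * w z)"
    using assms by (auto simp: reciprocal_form_def)
  have q: "(if z = 0 then 1 else z / f z) = 1 + z * w z"
    using nz by (simp add: f)
  have d: "deriv f z = (1 - z\<^sup>2 * deriv w z) / (1 + z * w z)\<^sup>2"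
    using reciprocal_form_has_derivative[OF assms] by (rule DERIV_imp_deriv)
  show ?thesis
    unfolding q d using nz by simp
qed

lemma class_A_reciprocal_form:
  assumes "f \<in> class_A" and nz: "\<forall>z\<in>ball 0 1. (if z = 0 then 1 else f z / z) \<noteq> 0"
  obtains w where "reciprocal_form f w"
proof -
  have holf: "f holomorphic_on ball 0 1" and f0: "f 0 = 0" and f1: "deriv f 0 = 1"
    using assms by (auto simp: class_A_def analytic_imp_holomorphic)
  obtain h where holh: "h holomorphic_on ball 0 1"
    and h: "\<And>z. norm z < 1 \<Longrightarrow> f z = z * h z" and "deriv f 0 = h 0"
    using Schwarz3[OF holf f0] by blast
  then have h0: "h 0 = 1" using f1 by simp
  have hnz: "h z \<noteq> 0" if "norm z < 1" for z
    using bspec[OF nz, of z] that h[OF that] h0 by (cases "z = 0") auto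
  have "(\<lambda>z. inverse (h z) - 1) holomorphic_on ball 0 1"
    using holh hnz by (intro holomorphic_intros) auto
  moreover have "inverse (h 0) - 1 = 0" using h0 by simp
  ultimately obtain w where holw: "w holomorphic_on ball 0 1"
    and w: "\<And>z. norm z < 1 \<Longrightarrow> inverse (h z) - 1 = z * w z"
    using Schwarz3[of "\<lambda>z. inverse (h z) - 1" 1] by blast
  have "1 + z * w z = inverse (h z)" if "norm z < 1" for z
    using w[OF that] by (simp add: algebra_simps)
  then have "1 + z * w z \<noteq> 0 \<and> f z = z / (1 + z * w z)" if "norm z < 1" for z
    using hnz[OF that] h[OF that] that by (simp add: divide_inverse)
  then have "reciprocal_form f w"
    using holw by (simp add: reciprocal_form_def)
  then show thesis by (rule that)
qed

lemma reciprocal_form_class_A: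
  assumes "reciprocal_form f w"
  shows "f \<in> class_A"
    and "\<forall>z\<in>ball 0 1. (if z = 0 then 1 else f z / z) \<noteq> 0"
proof -
  have "f holomorphic_on ball 0 1"
    unfolding holomorphic_on_open[OF open_ball]
    using reciprocal_form_has_derivative[OF assms] by blast
  then have "f analytic_on ball 0 1"
    by (simp add: analytic_on_open)
  moreover have "f 0 = 0"
    using assms by (auto simp: reciprocal_form_def)
  moreover have "deriv f 0 = 1"
    using reciprocal_form_has_derivative[OF assms, of 0] by (simp add: DERIV_imp_deriv)
  ultimately show "f \<in> class_A"
    by (simp add: class_A_def)
  show "\<forall>z\<in>ball 0 1. (if z = 0 then 1 else f z / z) \<noteq> 0"
    using assms by (auto simp: reciprocal_form_def)
qed

lemma class_U_lam_iff_reciprocal_form: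
  "f \<in> class_U_lam l \<longleftrightarrow>
     (\<exists>w. reciprocal_form f w \<and> (\<forall>z\<in>ball 0 1. norm (z\<^sup>2 * deriv w z) < l))"
proof
  assume f: "f \<in> class_U_lam l"
  then obtain w where w: "reciprocal_form f w"
    unfolding class_U_lam_def by (blast elim: class_A_reciprocal_form)
  moreover have "norm (z\<^sup>2 * deriv w z) < l" if "z \<in> ball 0 1" for z
  proof -
    have "norm (deriv f z * (if z = 0 then 1 else z / f z)\<^sup>2 - 1) < l"
      using f that unfolding class_U_lam_def by blast
    then show ?thesis
      by (simp only: reciprocal_form_U_functional[OF w that] norm_minus_cancel)
  qed
  ultimately show "\<exists>w. reciprocal_form f w \<and> (\<forall>z\<in>ball 0 1. norm (z\<^sup>2 * deriv w z) < l)"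
    by blast
next
  assume "\<exists>w. reciprocal_form f w \<and> (\<forall>z\<in>ball 0 1. norm (z\<^sup>2 * deriv w z) < l)"
  then obtain w where w: "reciprocal_form f w"
    and bound: "\<And>z. z \<in> ball 0 1 \<Longrightarrow> norm (z\<^sup>2 * deriv w z) < l" by blast
  have "norm (deriv f z * (if z = 0 then 1 else z / f z)\<^sup>2 - 1) < l" if "z \<in> ball 0 1" for z
    using bound[OF that] by (simp only: reciprocal_form_U_functional[OF w that] norm_minus_cancel)
  then show "f \<in> class_U_lam l"
    using reciprocal_form_class_A[OF w] unfolding class_U_lam_def by blast
qed

section \<open>Removing the double zero\<close>

text \<open>
  A Schwarz lemma of second order. On the circle of radius \<open>\<rho> < 1\<close> the hypothesis gives
  \<open>\<bar>v\<bar> \<le> l / \<rho>\<^sup>2\<close>; the maximum modulus principle carries this bound inside, and then \<open>\<rho>\<close> tends to 1.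
\<close>

lemma norm_le_of_norm_square_mult_le:
  assumes hol: "v holomorphic_on ball 0 1"
    and bound: "\<And>z. z \<in> ball 0 1 \<Longrightarrow> norm (z\<^sup>2 * v z) \<le> l"
    and z: "z \<in> ball 0 1"
  shows "norm (v z) \<le> l"
proof -
  have on_disc: "norm (v z) * \<rho>\<^sup>2 \<le> l" if \<rho>: "norm z < \<rho>" "\<rho> < 1" for \<rho>
  proof -
    have pos: "\<rho> > 0" using \<rho>(1) norm_ge_zero[of z] by linarith
    have sub: "cball 0 \<rho> \<subseteq> ball (0::complex) 1" using \<rho> by auto
    have holc: "v holomorphic_on cball 0 \<rho>"
      using hol sub by (rule holomorphic_on_subset)
    have "norm (v z) \<le> l / \<rho>\<^sup>2"
    proof (rule maximum_modulus_frontier[of v "cball 0 \<rho>"])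
      show "v holomorphic_on interior (cball 0 \<rho>)"
        using holc by (rule holomorphic_on_subset) (rule interior_subset)
      show "continuous_on (closure (cball 0 \<rho>)) v"
        using holc by (simp add: holomorphic_on_imp_continuous_on)
      show "norm (v x) \<le> l / \<rho>\<^sup>2" if "x \<in> frontier (cball 0 \<rho>)" for x
      proof -
        have "norm x = \<rho>" using that by simp
        then show ?thesis
          using bound[of x] \<rho> pos by (simp add: norm_mult norm_power field_simps)
      qed
    qed (use \<rho> in auto)
    then show ?thesis using pos by (simp add: field_simps)
  qed
  have "((\<lambda>\<rho>. norm (v z) * \<rho>\<^sup>2) \<longlongrightarrow> norm (v z) * 1\<^sup>2) (at_left (1::real))"
    by (intro tendsto_intros)
  moreover have "\<forall>\<^sub>F \<rho> in at_left 1. norm (v z) * \<rho>\<^sup>2 \<le> l"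
    using eventually_at_left_real[of "norm z" 1] z
    by (auto elim!: eventually_mono intro: on_disc)
  ultimately have "norm (v z) * 1\<^sup>2 \<le> l"
    by (rule tendsto_upperbound) simp
  then show ?thesis by simp
qed

lemma reciprocal_form_deriv_bound:
  assumes "reciprocal_form f w" "\<forall>z\<in>ball 0 1. norm (z\<^sup>2 * deriv w z) < l" "z \<in> ball 0 1"
  shows "norm (deriv w z) \<le> l"
  using assms norm_le_of_norm_square_mult_le[of "deriv w" l z]
  by (auto simp: reciprocal_form_def holomorphic_deriv less_imp_le)

section \<open>Harmonic means, dilations and univalence\<close>

lemma reciprocal_form_harmonic_mean:
  assumes f: "reciprocal_form f u" and g: "reciprocal_form g v"
    and nz: "\<forall>z\<in>ball 0 1. (if z = 0 then 2 else (f z + g z) / z) \<noteq> 0"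
  shows "reciprocal_form (harmonic_mean_fun f g) (\<lambda>z. (u z + v z) / 2)"
  unfolding reciprocal_form_def
proof (intro conjI ballI)
  show "(\<lambda>z. (u z + v z) / 2) holomorphic_on ball 0 1"
    using f g by (auto simp: reciprocal_form_def intro!: holomorphic_intros)
next
  fix z :: complex assume z: "z \<in> ball 0 1"
  define p q where "p = 1 + z * u z" and "q = 1 + z * v z"
  have pq: "p \<noteq> 0" "q \<noteq> 0" "f z = z / p" "g z = z / q"
    using f g z by (auto simp: reciprocal_form_def p_def q_def)
  have avg: "1 + z * ((u z + v z) / 2) = (p + q) / 2"
    by (simp add: p_def q_def algebra_simps add_divide_distrib)
  have sum: "p + q \<noteq> 0"
  proof (cases "z = 0")
    case True
    then show ?thesis by (simp add: p_def q_def)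
  next
    case False
    then have "(z / p + z / q) / z \<noteq> 0" using bspec[OF nz z] pq by simp
    also have "(z / p + z / q) / z = (p + q) / (p * q)"
      using False pq by (simp add: field_simps)
    finally show ?thesis by auto
  qed
  show "1 + z * ((u z + v z) / 2) \<noteq> 0"
    unfolding avg using sum by simp
  show "harmonic_mean_fun f g z = z / (1 + z * ((u z + v z) / 2))"
  proof (cases "z = 0")
    case False
    have "f z + g z = z * (p + q) / (p * q)"
      using pq by (simp add: field_simps)
    then have "harmonic_mean_fun f g z = 2 * (z / p) * (z / q) / (z * (p + q) / (p * q))"
      using False pq by (simp add: harmonic_mean_fun_def)
    also have "\<dots> = z / ((p + q) / 2)"
      using False pq sum by (simp add: divide_simps)
    finally show ?thesis by (simp only: avg)
  qed (simp add: harmonic_mean_fun_def)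
qed

lemma harmonic_mean_in_class_U_lam:
  assumes "f \<in> class_U_lam l1" "g \<in> class_U_lam l2"
    and nz: "\<forall>z\<in>ball 0 1. (if z = 0 then 2 else (f z + g z) / z) \<noteq> 0"
  shows "harmonic_mean_fun f g \<in> class_U_lam ((l1 + l2) / 2)"
proof -
  obtain u v where u: "reciprocal_form f u" "\<forall>z\<in>ball 0 1. norm (z\<^sup>2 * deriv u z) < l1"
    and v: "reciprocal_form g v" "\<forall>z\<in>ball 0 1. norm (z\<^sup>2 * deriv v z) < l2"
    using assms(1,2) unfolding class_U_lam_iff_reciprocal_form by blast
  have "norm (z\<^sup>2 * deriv (\<lambda>z. (u z + v z) / 2) z) < (l1 + l2) / 2" if z: "z \<in> ball 0 1" for z
  proof -
    have "(u has_field_derivative deriv u z) (at z)" "(v has_field_derivative deriv v z) (at z)"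
      using u(1) v(1) z unfolding reciprocal_form_def by (blast intro: holomorphic_derivI)+
    then have "((\<lambda>z. (u z + v z) / 2) has_field_derivative (deriv u z + deriv v z) / 2) (at z)"
      by (auto intro!: DERIV_cdivide DERIV_add)
    then have "z\<^sup>2 * deriv (\<lambda>z. (u z + v z) / 2) z = (z\<^sup>2 * deriv u z + z\<^sup>2 * deriv v z) / 2"
      by (simp add: DERIV_imp_deriv algebra_simps)
    then have "norm (z\<^sup>2 * deriv (\<lambda>z. (u z + v z) / 2) z)
        = norm (z\<^sup>2 * deriv u z + z\<^sup>2 * deriv v z) / 2"
      by (simp only: norm_divide norm_numeral)
    also have "\<dots> \<le> (norm (z\<^sup>2 * deriv u z) + norm (z\<^sup>2 * deriv v z)) / 2"
      by (intro divide_right_mono norm_triangle_ineq) simp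
    also have "\<dots> < (l1 + l2) / 2"
      using u(2) v(2) z by (intro divide_strict_right_mono add_strict_mono) auto
    finally show ?thesis .
  qed
  then show ?thesis
    using reciprocal_form_harmonic_mean[OF u(1) v(1) nz]
    unfolding class_U_lam_iff_reciprocal_form by blast
qed

text \<open>
  Dilating by \<open>r\<close> turns \<open>w z\<close> into \<open>r * w (r * z)\<close> and thus gains a factor \<open>r\<^sup>2\<close> in the derivative.
\<close>

lemma dilation_in_class_U_lam:
  assumes F: "F \<in> class_U_lam m" and r: "0 < r" "r \<le> 1" and l: "0 < l" "r\<^sup>2 * m \<le> l"
  shows "dilation r F \<in> class_U_lam l"
proof -
  obtain w where w: "reciprocal_form F w" "\<forall>z\<in>ball 0 1. norm (z\<^sup>2 * deriv w z) < m"
    using F unfolding class_U_lam_iff_reciprocal_form by blast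
  define c where "c = complex_of_real r"
  have c: "c \<noteq> 0" "norm c = r" using r by (auto simp: c_def)
  have in_disk: "c * z \<in> ball 0 1" if "z \<in> ball 0 1" for z
  proof -
    have "r * norm z \<le> 1 * norm z" using r by (intro mult_right_mono) auto
    then show ?thesis using that c by (simp add: norm_mult)
  qed
  have holw: "w holomorphic_on ball 0 1" using w(1) by (simp add: reciprocal_form_def)
  have "reciprocal_form (dilation r F) (\<lambda>z. c * w (c * z))"
    unfolding reciprocal_form_def
  proof (intro conjI ballI)
    have "w \<circ> (\<lambda>z. c * z) holomorphic_on ball 0 1"
      using in_disk by (intro holomorphic_on_compose_gen[OF _ holw] holomorphic_intros) auto
    then show "(\<lambda>z. c * w (c * z)) holomorphic_on ball 0 1"
      by (intro holomorphic_intros) (simp add: o_def)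
  next
    fix z :: complex assume "z \<in> ball 0 1"
    then have *: "1 + c * z * w (c * z) \<noteq> 0" "F (c * z) = c * z / (1 + c * z * w (c * z))"
      using w(1) in_disk unfolding reciprocal_form_def by blast+
    then show "1 + z * (c * w (c * z)) \<noteq> 0"
      by (simp add: mult_ac)
    show "dilation r F z = z / (1 + z * (c * w (c * z)))"
      using c * by (simp add: dilation_def mult_ac flip: c_def)
  qed
  moreover have "norm (z\<^sup>2 * deriv (\<lambda>z. c * w (c * z)) z) < l" if z: "z \<in> ball 0 1" for z
  proof -
    have "(w has_field_derivative deriv w (c * z)) (at (c * z))"
      using holw in_disk[OF z] by (auto intro: holomorphic_derivI)
    then have "((\<lambda>z. w (c * z)) has_field_derivative deriv w (c * z) * c) (at z)"
      by (rule DERIV_chain2) (auto intro!: derivative_eq_intros)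
    then have "((\<lambda>z. c * w (c * z)) has_field_derivative c * (deriv w (c * z) * c)) (at z)"
      by (rule DERIV_cmult)
    then have "deriv (\<lambda>z. c * w (c * z)) z = c * (deriv w (c * z) * c)"
      by (rule DERIV_imp_deriv)
    then have "norm (z\<^sup>2 * deriv (\<lambda>z. c * w (c * z)) z)
        = (norm z)\<^sup>2 * (r\<^sup>2 * norm (deriv w (c * z)))"
      by (simp add: norm_mult norm_power c power2_eq_square)
    also have "\<dots> \<le> (norm z)\<^sup>2 * (r\<^sup>2 * m)"
      using reciprocal_form_deriv_bound[OF w in_disk[OF z]] by (intro mult_left_mono) auto
    also have "\<dots> \<le> (norm z)\<^sup>2 * l"
      using l by (intro mult_left_mono) auto
    also have "\<dots> < 1 * l"
      using z l by (intro mult_strict_right_mono) (auto simp: power_less_one_iff)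
    finally show ?thesis by simp
  qed
  ultimately show ?thesis
    unfolding class_U_lam_iff_reciprocal_form by blast
qed

text \<open>
  If two nonzero points had the same image, then \<open>\<bar>1 / x - 1 / y\<bar> = \<bar>w x - w y\<bar> \<le> \<bar>x - y\<bar>\<close>; but the
  left-hand side is \<open>\<bar>x - y\<bar> / \<bar>x * y\<bar>\<close>, which is strictly larger.
\<close>

lemma class_U_inj_on:
  assumes "f \<in> class_U"
  shows "inj_on f (ball 0 1)"
proof (rule inj_onI)
  fix x y :: complex
  assume xy: "x \<in> ball 0 1" "y \<in> ball 0 1" and eq: "f x = f y"
  obtain w where w: "reciprocal_form f w" "\<forall>z\<in>ball 0 1. norm (z\<^sup>2 * deriv w z) < 1"
    using assms unfolding class_U_def class_U_lam_iff_reciprocal_form by blast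
  have holw: "w holomorphic_on ball 0 1" using w(1) by (simp add: reciprocal_form_def)
  have nz: "1 + x * w x \<noteq> 0" "1 + y * w y \<noteq> 0"
    and eq': "x / (1 + x * w x) = y / (1 + y * w y)"
    using w(1) xy eq by (auto simp: reciprocal_form_def)
  have nonexpansive: "norm (w x - w y) \<le> 1 * norm (x - y)"
  proof (rule field_differentiable_bound[where S = "ball 0 1" and f' = "deriv w"])
    show "(w has_field_derivative deriv w z) (at z within ball 0 1)" if "z \<in> ball 0 1" for z
      using holomorphic_derivI[OF holw open_ball that] .
    show "norm (deriv w z) \<le> 1" if "z \<in> ball 0 1" for z
      using reciprocal_form_deriv_bound[OF w that] .
  qed (use xy in auto)
  show "x = y"
  proof (rule ccontr)
    assume ne: "x \<noteq> y"
    have "x - y = x * y * (w x - w y)"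
      using eq' nz by (simp add: frac_eq_eq algebra_simps)
    from arg_cong[OF this, of norm] have "norm (x - y) = norm (x * y) * norm (w x - w y)"
      by (simp only: norm_mult)
    also have "\<dots> \<le> norm (x * y) * norm (x - y)"
      using nonexpansive by (intro mult_left_mono) auto
    finally have "1 \<le> norm (x * y)"
      using ne by simp
    moreover have "norm x * norm y < 1 * 1"
      using xy by (intro mult_strict_mono') auto
    ultimately show False by (simp add: norm_mult)
  qed
qed

section \<open>The radius\<close>

text \<open>
  With \<open>s = sqrt (K\<^sup>2 + 4)\<close> the square of the radius is \<open>K * (s - K) / 2\<close>. Since \<open>s\<^sup>2 = K\<^sup>2 + 4\<close>,
  the inequality \<open>(s - K)\<^sup>2 \<ge> 0\<close> says that this is at most 1. Since \<open>s \<le> K + 2\<close>, it is also at most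
  \<open>K\<close>, and \<open>l1\<close> and \<open>l2\<close> being at most 1 gives \<open>l \<le> K\<close>, hence \<open>K \<le> K\<^sup>2 / l = 2 * l / (l1 + l2)\<close>.
\<close>

lemma radius_bounds:
  fixes l1 l2 l r :: real
  assumes l: "0 < l1" "l1 \<le> 1" "0 < l2" "l2 \<le> 1" "0 < l"
    and r: "0 < r" "r \<le> sqrt ((- K\<^sup>2 + K * sqrt (K\<^sup>2 + 4)) / 2)"
    and K: "K = K_const l1 l2 l"
  shows "r \<le> 1" "r\<^sup>2 * ((l1 + l2) / 2) \<le> l"
proof -
  have K2: "K\<^sup>2 = 2 * l\<^sup>2 / (l1 + l2)" and Kpos: "0 < K"
    using l by (auto simp: K K_const_def)
  have "l\<^sup>2 * (l1 + l2) \<le> l\<^sup>2 * 2"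
    using l by (intro mult_left_mono) auto
  then have "l\<^sup>2 \<le> K\<^sup>2"
    unfolding K2 using l by (subst pos_le_divide_eq) (auto simp: mult.commute)
  then have lK: "l \<le> K"
    by (rule power2_le_imp_le) (use Kpos in simp)
  define s where "s = sqrt (K\<^sup>2 + 4)"
  have s2: "s\<^sup>2 = K\<^sup>2 + 4" by (simp add: s_def)
  have "s \<le> K + 2"
    unfolding s_def using Kpos by (intro real_le_lsqrt) (auto simp: power2_eq_square algebra_simps)
  then have rad_K: "(- K\<^sup>2 + K * s) / 2 \<le> K"
    using Kpos mult_left_mono[of s "K + 2" K] by (simp add: power2_eq_square algebra_simps)
  have rad_1: "(- K\<^sup>2 + K * s) / 2 \<le> 1"
  proof -
    have "0 \<le> (s - K)\<^sup>2" by simp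
    then show ?thesis using s2 by (simp add: power2_eq_square algebra_simps)
  qed
  have r2: "r\<^sup>2 \<le> (- K\<^sup>2 + K * s) / 2"
    using r unfolding s_def by (intro sqrt_ge_absD) (simp only: abs_of_pos)
  then have "r\<^sup>2 \<le> 1\<^sup>2" using rad_1 by simp
  then show "r \<le> 1" by (rule power2_le_imp_le) simp
  have "r\<^sup>2 * l \<le> K * K"
    using r2 rad_K lK l Kpos by (intro mult_mono) auto
  then have "r\<^sup>2 * l \<le> 2 * l\<^sup>2 / (l1 + l2)"
    using K2 by (simp add: power2_eq_square)
  then have "(r\<^sup>2 * ((l1 + l2) / 2)) * l \<le> l * l"
    using l by (simp add: field_simps power2_eq_square)
  then show "r\<^sup>2 * ((l1 + l2) / 2) \<le> l"
    using l by simp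
qed

theorem theorem2:
  fixes f g :: "complex \<Rightarrow> complex"
  assumes "\<forall>z\<in>ball 0 1. (if z = 0 then 2 else (f z + g z) / z) \<noteq> 0"
  shows "(\<forall>l1\<in>{0<..1}. \<forall>l2\<in>{0<..1}. \<forall>l\<in>{0<..1}.
            f \<in> class_U_lam l1 \<longrightarrow> g \<in> class_U_lam l2 \<longrightarrow>
            (let K = K_const l1 l2 l in
              \<forall>r. 0 < r \<and> r \<le> sqrt ((- K\<^sup>2 + K * sqrt (K\<^sup>2 + 4)) / 2) \<longrightarrow>
                dilation r (harmonic_mean_fun f g) \<in> class_U_lam l)) \<and>
         (f \<in> class_U \<longrightarrow> g \<in> class_U \<longrightarrow>
            (\<forall>r. 0 < r \<and> r \<le> sqrt ((sqrt 5 - 1) / 2) \<longrightarrow>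
                dilation r (harmonic_mean_fun f g) \<in> class_U) \<and>
            inj_on (harmonic_mean_fun f g) (ball 0 (sqrt ((sqrt 5 - 1) / 2))))"
proof (intro conjI ballI impI)
  fix l1 l2 l :: real
  assume l: "l1 \<in> {0<..1}" "l2 \<in> {0<..1}" "l \<in> {0<..1}"
    and fg: "f \<in> class_U_lam l1" "g \<in> class_U_lam l2"
  have "dilation r (harmonic_mean_fun f g) \<in> class_U_lam l"
    if "0 < r" "r \<le> sqrt ((- K\<^sup>2 + K * sqrt (K\<^sup>2 + 4)) / 2)" "K = K_const l1 l2 l" for r K
    using dilation_in_class_U_lam[OF harmonic_mean_in_class_U_lam[OF fg assms], of r l]
      radius_bounds[of l1 l2 l r K] l that by auto
  then show "let K = K_const l1 l2 l in
      \<forall>r. 0 < r \<and> r \<le> sqrt ((- K\<^sup>2 + K * sqrt (K\<^sup>2 + 4)) / 2) \<longrightarrow>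
        dilation r (harmonic_mean_fun f g) \<in> class_U_lam l"
    by (simp add: Let_def)
next
  assume fg: "f \<in> class_U" "g \<in> class_U"
  have F: "harmonic_mean_fun f g \<in> class_U"
    using harmonic_mean_in_class_U_lam[of f 1 g 1] fg assms by (simp add: class_U_def)
  have "sqrt 5 \<le> 3"
    by (rule real_le_lsqrt) auto
  then have radius: "sqrt ((sqrt 5 - 1) / 2) \<le> 1"
    by simp
  show "\<forall>r. 0 < r \<and> r \<le> sqrt ((sqrt 5 - 1) / 2) \<longrightarrow>
      dilation r (harmonic_mean_fun f g) \<in> class_U"
  proof (intro allI impI)
    fix r :: real assume "0 < r \<and> r \<le> sqrt ((sqrt 5 - 1) / 2)"
    then have r: "0 < r" "r \<le> 1" using order_trans[OF _ radius, of r] by blast+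
    then show "dilation r (harmonic_mean_fun f g) \<in> class_U"
      using F unfolding class_U_def
      by (intro dilation_in_class_U_lam[of _ 1]) (auto simp: power_le_one)
  qed
  show "inj_on (harmonic_mean_fun f g) (ball 0 (sqrt ((sqrt 5 - 1) / 2)))"
    using class_U_inj_on[OF F] subset_ball[OF radius] by (rule inj_on_subset)
qed

end
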